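(* Let $\varphi:\mathbb{D}\to\mathbb{D}$ and $w:\mathbb{D}\to\mathbb{C}$ be holomorphic, and let $\mu$ be the measure on Borel subsets $A$ of $\mathbb{D}$ defined by $$\mu(A)=\int_{\varphi^{-1}(A)}|w(z)|^2\,dm(z),$$ where $m$ denotes normalized area (Lebesgue) measure on $\mathbb{D}$. Then the weighted composition operator $T_{w,\varphi}$ is an isometry on the Bergman space $A^2$ if and only if $\mu=m$.
   Context: $\mathbb{D}$ is the open unit disc. $A^2$ is the Bergman space of holomorphic functions $f$ on $\mathbb{D}$ with $\|f\|_{A^2}^2=\int_{\mathbb{D}}|f|^2\,dm<\infty$. The weighted composition operator is $(T_{w,\varphi}f)(z)=w(z)f(\varphi(z))$ for $f\in A^2$, $z\in\mathbb{D}$. It is an isometry on $A^2$ if $\|T_{w,\varphi}f\|_{A^2}=\|f\|_{A^2}$ for all $f\in A^2$ (not necessarily surjective). *)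

theory Defs
  imports "HOL-Analysis.Analysis"
begin

abbreviation unit_disc :: "complex set" where
  "unit_disc \<equiv> ball 0 1"

definition disc_measure :: "complex measure" where
  "disc_measure = scale_measure (ennreal (1 / pi)) (restrict_space lborel unit_disc)"

lemma space_disc_measure [simp]: "space disc_measure = unit_disc"
  by (simp add: disc_measure_def space_scale_measure space_restrict_space)

lemma sets_disc_measure: "sets disc_measure = {A. A \<in> sets borel \<and> A \<subseteq> unit_disc}"
  by (auto simp: disc_measure_def sets_scale_measure sets_restrict_space)

lemma emeasure_disc_measure:
  assumes "A \<in> sets borel" "A \<subseteq> unit_disc"
  shows "emeasure disc_measure A = ennreal (1 / pi) * emeasure lborel A"
  using assms by (simp add: disc_measure_def emeasure_restrict_space)

lemma emeasure_disc_measure_unit_disc: "emeasure disc_measure unit_disc = 1"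
proof -
  have "emeasure lborel unit_disc = ennreal pi"
    using emeasure_ball[of 1 "0::complex"] by (simp add: unit_ball_vol_2)
  then show ?thesis
    by (simp add: emeasure_disc_measure ennreal_mult[symmetric])
qed

text \<open>Elements of \<open>A\<^sup>2\<close> are represented by total functions on the complex plane;
  their values outside the disc are irrelevant.\<close>

definition bergman_space :: "(complex \<Rightarrow> complex) set" where
  "bergman_space =
     {f. f holomorphic_on unit_disc \<and> integrable disc_measure (\<lambda>z. (cmod (f z))\<^sup>2)}"

definition bergman_norm :: "(complex \<Rightarrow> complex) \<Rightarrow> real" where
  "bergman_norm f = sqrt (LINT z|disc_measure. (cmod (f z))\<^sup>2)"

definition weighted_comp ::
    "(complex \<Rightarrow> complex) \<Rightarrow> (complex \<Rightarrow> complex) \<Rightarrow> (complex \<Rightarrow> complex) \<Rightarrow> complex \<Rightarrow> complex" where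
  "weighted_comp w \<phi> f z = w z * f (\<phi> z)"

text \<open>The condition \<open>T f \<in> bergman_space\<close> is what makes \<open>\<parallel>T f\<parallel>\<close> meaningful:
  the Bochner integral in \<open>bergman_norm\<close> is 0 for functions of infinite norm.\<close>

definition bergman_isometry :: "((complex \<Rightarrow> complex) \<Rightarrow> complex \<Rightarrow> complex) \<Rightarrow> bool" where
  "bergman_isometry T \<longleftrightarrow>
     (\<forall>f\<in>bergman_space. T f \<in> bergman_space \<and> bergman_norm (T f) = bergman_norm f)"

definition weighted_pushforward ::
    "(complex \<Rightarrow> complex) \<Rightarrow> (complex \<Rightarrow> complex) \<Rightarrow> complex measure" where
  "weighted_pushforward w \<phi> =
     distr (density disc_measure (\<lambda>z. ennreal ((cmod (w z))\<^sup>2))) disc_measure \<phi>"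

lemma holomorphic_measurable_disc:
  assumes "f holomorphic_on unit_disc"
  shows "f \<in> borel_measurable disc_measure"
proof -
  have "f \<in> borel_measurable (restrict_space borel unit_disc)"
    by (intro borel_measurable_continuous_on_restrict holomorphic_on_imp_continuous_on assms)
  moreover have "sets disc_measure = sets (restrict_space borel unit_disc)"
    by (auto simp: sets_disc_measure sets_restrict_space)
  ultimately show ?thesis
    using measurable_cong_sets by blast
qed

lemma emeasure_weighted_pushforward:
  assumes \<phi>: "\<phi> holomorphic_on unit_disc" "\<phi> \<in> unit_disc \<rightarrow> unit_disc"
    and w: "w holomorphic_on unit_disc"
    and A: "A \<in> sets borel" "A \<subseteq> unit_disc"
  shows "emeasure (weighted_pushforward w \<phi>) A =
    (\<integral>\<^sup>+z\<in>\<phi> -` A \<inter> unit_disc. ennreal ((cmod (w z))\<^sup>2) \<partial>disc_measure)"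
proof -
  have [measurable]: "w \<in> borel_measurable disc_measure"
    using w by (rule holomorphic_measurable_disc)
  have "\<phi> -` B \<inter> unit_disc \<in> sets disc_measure" if "B \<in> sets disc_measure" for B
    using measurable_sets[OF holomorphic_measurable_disc[OF \<phi>(1)], of B] that
    by (auto simp: sets_disc_measure)
  then have m: "\<phi> \<in> measurable disc_measure disc_measure"
    using \<phi>(2) by (auto intro!: measurableI)
  then have "\<phi> -` A \<inter> unit_disc \<in> sets disc_measure"
    using measurable_sets[OF m, of A] A by (auto simp: sets_disc_measure)
  then show ?thesis
    using m A by (simp add: weighted_pushforward_def emeasure_distr emeasure_density sets_disc_measure)
qed

end

(* The isometry property says that integrating |f|^2 against mu and against m gives the same value
   for every f in A^2.  Polarising over polynomials, the mixed moments z^j (cnj z)^k of mu and m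
   agree; by Stone-Weierstrass on the closed disc so do the integrals of all continuous functions,
   hence the measures.  The converse is the change of variables formula. *)

theory Submission
  imports Defs
begin

text \<open>Open sets form an intersection-stable generator of the Borel sets, and the indicator of
  an open set is a pointwise limit of continuous functions with values in [0, 1]. Dominated
  convergence then carries the equality from integrals to open sets.\<close>

lemma finite_measure_eqI_integral_continuous:
  fixes M N :: "'a::metric_space measure"
  assumes fin: "finite_measure M" "finite_measure N"
    and sets: "sets M = sets borel" "sets N = sets borel"
    and eq: "\<And>h :: 'a \<Rightarrow> real. continuous_on UNIV h \<Longrightarrow> (\<And>x. 0 \<le> h x) \<Longrightarrow> (\<And>x. h x \<le> 1) \<Longrightarrow>
      (LINT x|M. h x) = (LINT x|N. h x)"
  shows "M = N"
proof (rule measure_eqI_generator_eq[where E = "Collect open" and \<Omega> = UNIV and A = "\<lambda>_. UNIV"])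
  interpret M: finite_measure M by fact
  interpret N: finite_measure N by fact
  show "Int_stable (Collect open :: 'a set set)" by (auto simp: Int_stable_def)
  show "sets M = sigma_sets UNIV (Collect open)" "sets N = sigma_sets UNIV (Collect open)"
    using sets by (simp_all add: borel_def)
  show "emeasure M UNIV \<noteq> \<infinity>" by simp
  fix U :: "'a set" assume "U \<in> Collect open"
  then have U: "open U" by simp
  \<comment> \<open>By convention \<open>infdist\<close> to the empty set is 0, so the whole space
    needs its own case: there the cutoff formula would give 0 instead of 1.\<close>
  define h where "h n x = (if U = UNIV then 1 else min 1 (real n * infdist x (- U)))" for n x
  have cont: "continuous_on UNIV (h n)" for n
    unfolding h_def by (cases "U = UNIV") (auto intro!: continuous_intros)
  have bd: "0 \<le> h n x" "h n x \<le> 1" for n x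
    by (auto simp: h_def infdist_nonneg)
  have lim: "(\<lambda>n. h n x) \<longlonglongrightarrow> indicator U x" for x
  proof (cases "U = UNIV")
    case False
    show ?thesis
    proof (cases "x \<in> U")
      case True
      then have "infdist x (- U) \<noteq> 0"
        using in_closed_iff_infdist_zero[of "- U" x] U False by auto
      then have pos: "infdist x (- U) > 0" using infdist_nonneg[of x "- U"] by linarith
      \<comment> \<open>Beyond the reciprocal of the distance to the complement the minimum equals
        1, so the sequence is eventually constant.\<close>
      obtain n0 :: nat where n0: "1 / infdist x (- U) \<le> real n0"
        using real_arch_simple by blast
      have "h n x = 1" if "n \<ge> n0" for n
      proof -
        have "1 / infdist x (- U) \<le> real n" using n0 that by linarith
        then have "1 \<le> real n * infdist x (- U)" using pos by (simp add: divide_le_eq)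
        then show ?thesis using False by (simp add: h_def)
      qed
      then have "eventually (\<lambda>n. h n x = 1) sequentially"
        by (auto simp: eventually_sequentially)
      then show ?thesis using True by (simp add: tendsto_eventually)
    next
      case xU: False
      then have "infdist x (- U) = 0" by simp
      then show ?thesis using xU False by (simp add: h_def)
    qed
  qed (simp add: h_def)
  have *: "(\<lambda>n. LINT x|K. h n x) \<longlonglongrightarrow> measure K U"
    if K: "finite_measure K" "sets K = sets borel" for K
  proof -
    interpret K: finite_measure K by fact
    have m: "h n \<in> borel_measurable K" for n
      using borel_measurable_continuous_onI[OF cont] K(2) measurable_cong_sets by blast
    have "(\<lambda>n. LINT x|K. h n x) \<longlonglongrightarrow> (LINT x|K. indicator U x)"
    proof (rule integral_dominated_convergence[where w = "\<lambda>_. 1"])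
      show "(indicator U :: 'a \<Rightarrow> real) \<in> borel_measurable K"
        using K(2) U by (simp add: borel_measurable_indicator_iff)
    qed (use m lim bd in auto)
    moreover have "space K = UNIV" using sets_eq_imp_space_eq[OF K(2)] by simp
    ultimately show ?thesis by simp
  qed
  have "measure M U = measure N U"
    using LIMSEQ_unique[OF *[OF fin(1) sets(1)]] *[OF fin(2) sets(2)] eq[OF cont bd] by simp
  then show "emeasure M U = emeasure N U"
    by (simp add: M.emeasure_eq_measure N.emeasure_eq_measure)
qed auto

text \<open>These are the complex-valued polynomials in the real and imaginary parts of z.
  Generating them from monomials by sums alone makes any additive statement an induction whose base
  case is about the moments.\<close>

inductive bipolynomial :: "(complex \<Rightarrow> complex) \<Rightarrow> bool" where
  monomial: "bipolynomial (\<lambda>z. c * (z ^ j * cnj z ^ k))"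
| add: "bipolynomial f \<Longrightarrow> bipolynomial g \<Longrightarrow> bipolynomial (\<lambda>z. f z + g z)"

lemma bipolynomial_mult:
  assumes "bipolynomial f" "bipolynomial g"
  shows "bipolynomial (\<lambda>z. f z * g z)"
  using assms
proof (induction f)
  case (monomial c j k)
  from monomial show ?case
  proof (induction g)
    case (monomial d l m)
    have "(\<lambda>z. c * (z ^ j * cnj z ^ k) * (d * (z ^ l * cnj z ^ m)))
        = (\<lambda>z. (c * d) * (z ^ (j + l) * cnj z ^ (k + m)))"
      by (auto simp: power_add algebra_simps)
    then show ?case by (simp only: bipolynomial.monomial)
  qed (auto simp only: distrib_left intro: bipolynomial.add)
qed (auto simp only: distrib_right intro: bipolynomial.add)

lemma bipolynomial_of_real_polynomial:
  assumes "real_polynomial_function p"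
  shows "bipolynomial (\<lambda>z. of_real (p z))"
  using assms
proof induction
  case (linear p)
  interpret bounded_linear p by fact
  \<comment> \<open>With x = (z + \<open>cnj z\<close>)/2 and y = (z - \<open>cnj z\<close>)/(2i),
    substitute into p z = x * p 1 + y * p i and collect the coefficients of z and
    \<open>cnj z\<close>.\<close>
  have "of_real (p z) = (of_real (p 1) - \<i> * of_real (p \<i>)) / 2 * (z ^ 1 * cnj z ^ 0)
      + (of_real (p 1) + \<i> * of_real (p \<i>)) / 2 * (z ^ 0 * cnj z ^ 1)" for z
  proof -
    have "z = Re z *\<^sub>R 1 + Im z *\<^sub>R \<i>" by (simp add: complex_eq_iff)
    then have "p z = p (Re z *\<^sub>R 1 + Im z *\<^sub>R \<i>)" by simp
    also have "\<dots> = Re z * p 1 + Im z * p \<i>" by (simp only: add scaleR real_scaleR_def)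
    finally show ?thesis by (simp add: complex_eq_iff field_simps)
  qed
  then show ?case
    by (subst ext) (assumption, intro bipolynomial.intros)
next
  case (const c)
  show ?case using bipolynomial.monomial[of "of_real c" 0 0] by simp
qed (simp_all add: bipolynomial.add bipolynomial_mult)

lemma continuous_bipolynomial:
  "bipolynomial f \<Longrightarrow> continuous_on S f"
  by (induction f rule: bipolynomial.induct) (auto intro!: continuous_intros)

text \<open>The compact set carries the measure, not the function: f is bounded on \<open>K\<close>,
  hence bounded almost everywhere, and the total mass is finite.\<close>

lemma integrable_continuous_compact_support:
  fixes f :: "'a::topological_space \<Rightarrow> 'b::{banach, second_countable_topology}"
  assumes "finite_measure M" "sets M = sets borel" "AE x in M. x \<in> K" "compact K"
    and f: "continuous_on UNIV f"
  shows "integrable M f"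
proof -
  interpret finite_measure M by fact
  have "compact (f ` K)"
    by (rule compact_continuous_image[OF continuous_on_subset[OF f subset_UNIV] assms(4)])
  then obtain B where "\<forall>y\<in>f ` K. norm y \<le> B"
    using compact_imp_bounded bounded_iff by metis
  moreover have "f \<in> borel_measurable M"
    using borel_measurable_continuous_onI[OF f] assms(2) measurable_cong_sets by blast
  ultimately show ?thesis
    using assms(3) by (intro integrable_const_bound[where B = B]) auto
qed

text \<open>By linearity the moments fix the integrals of all real polynomials. Stone-Weierstrass
  approximates a continuous function uniformly on \<open>K\<close>, where both measures are
  concentrated.\<close>

lemma finite_measure_eqI_moments:
  fixes M N :: "complex measure"
  assumes fin: "finite_measure M" "finite_measure N"
    and sets: "sets M = sets borel" "sets N = sets borel"
    and supp: "AE z in M. z \<in> K" "AE z in N. z \<in> K" and K: "compact K"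
    and moments: "\<And>j k. (LINT z|M. z ^ j * cnj z ^ k) = (LINT z|N. z ^ j * cnj z ^ k)"
  shows "M = N"
proof (rule finite_measure_eqI_integral_continuous[OF fin sets])
  note intM = integrable_continuous_compact_support[OF fin(1) sets(1) supp(1) K]
  note intN = integrable_continuous_compact_support[OF fin(2) sets(2) supp(2) K]
  have bi: "(LINT z|M. f z) = (LINT z|N. f z)" if "bipolynomial f" for f
    using that
  proof induction
    case (add f g)
    then show ?case
      by (simp add: intM intN continuous_bipolynomial)
  qed (simp add: moments)
  have re: "(LINT z|M. p z) = (LINT z|N. p z)" if "real_polynomial_function p" for p
    using bi[OF bipolynomial_of_real_polynomial[OF that]] by simp
  fix h :: "complex \<Rightarrow> real"
  assume h: "continuous_on UNIV h"
  define C where "C = measure M UNIV + measure N UNIV"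
  have C: "C \<ge> 0" by (simp add: C_def)
  \<comment> \<open>The summand 0 gives the inequality the shape that
    \<open>field_le_epsilon\<close> expects.\<close>
  have "\<bar>(LINT z|M. h z) - (LINT z|N. h z)\<bar> \<le> 0 + e" if e: "e > 0" for e
  proof -
    \<comment> \<open>Passing through p costs at most d times the total mass of each measure,
      together d * C. Adding 1 keeps the denominator positive when both measures vanish.\<close>
    define d where "d = e / (C + 1)"
    have d: "d > 0" "d * C \<le> e" using e C by (auto simp: d_def field_simps)
    obtain p where p: "real_polynomial_function p" "\<And>z. z \<in> K \<Longrightarrow> \<bar>h z - p z\<bar> < d"
      using Stone_Weierstrass_real_polynomial_function[OF K continuous_on_subset[OF h] d(1)]
      by auto
    have pc: "continuous_on UNIV p"
      by (simp add: p(1) continuous_real_polymonial_function continuous_at_imp_continuous_on)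
    have *: "\<bar>(LINT z|L. h z) - (LINT z|L. p z)\<bar> \<le> d * measure L UNIV"
      if L: "finite_measure L" "sets L = sets borel" "AE z in L. z \<in> K" for L
    proof -
      interpret L: finite_measure L by fact
      note int = integrable_continuous_compact_support[OF L K]
      have "\<bar>(LINT z|L. h z) - (LINT z|L. p z)\<bar> = \<bar>LINT z|L. h z - p z\<bar>"
        by (simp only: Bochner_Integration.integral_diff[OF int[OF h] int[OF pc]])
      also have "\<dots> \<le> (LINT z|L. \<bar>h z - p z\<bar>)"
        by (rule integral_abs_bound)
      also have "\<dots> \<le> (LINT z|L. d)"
        by (rule integral_mono_AE) (use L(3) p(2) h pc in \<open>auto intro!: int continuous_intros less_imp_le\<close>)
      also have "\<dots> = d * measure L UNIV"
        using sets_eq_imp_space_eq[OF L(2)] by simp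
      finally show ?thesis .
    qed
    show ?thesis
      using *[OF fin(1) sets(1) supp(1)] *[OF fin(2) sets(2) supp(2)] re[OF p(1)] d(2)
      by (simp add: C_def distrib_left)
  qed
  then have "\<bar>(LINT z|M. h z) - (LINT z|N. h z)\<bar> \<le> 0"
    by (rule field_le_epsilon)
  then show "(LINT z|M. h z) = (LINT z|N. h z)" by simp
qed

lemma finite_measure_disc_measure: "finite_measure disc_measure"
  by (rule finite_measureI) (simp add: emeasure_disc_measure_unit_disc)

text \<open>Polarisation recovers the mixed moments from squared moduli of polynomials, which all
  lie in the Bergman space.\<close>

lemma disc_measure_eqI_bergman:
  assumes sets: "sets M = sets disc_measure"
    and int: "\<And>f. f \<in> bergman_space \<Longrightarrow> integrable M (\<lambda>z. (cmod (f z))\<^sup>2)"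
    and eq: "\<And>f. f \<in> bergman_space \<Longrightarrow>
      (LINT z|M. (cmod (f z))\<^sup>2) = (LINT z|disc_measure. (cmod (f z))\<^sup>2)"
  shows "M = disc_measure"
proof -
  interpret D: finite_measure disc_measure by (rule finite_measure_disc_measure)
  \<comment> \<open>An entire function is bounded on the closed disc, and
    \<open>disc_measure\<close> is finite.\<close>
  have bergman: "f \<in> bergman_space" if f: "continuous_on UNIV f" "f holomorphic_on UNIV" for f
  proof -
    have "compact (f ` cball 0 1)"
      by (rule compact_continuous_image[OF continuous_on_subset[OF f(1) subset_UNIV] compact_cball])
    then obtain B where B: "\<forall>y\<in>f ` cball 0 1. norm y \<le> B"
      using compact_imp_bounded bounded_iff by metis
    have hol: "f holomorphic_on unit_disc"
      using f(2) holomorphic_on_subset by blast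
    have [measurable]: "f \<in> borel_measurable disc_measure"
      using hol by (rule holomorphic_measurable_disc)
    have "integrable disc_measure (\<lambda>z. (cmod (f z))\<^sup>2)"
      by (rule D.integrable_const_bound[where B = "B\<^sup>2"]) (use B in \<open>auto intro!: AE_I2 power_mono\<close>)
    with hol show ?thesis by (simp add: bergman_space_def)
  qed
  \<comment> \<open>The constant function 1 shows that M has finite mass.\<close>
  have "integrable M (\<lambda>z. 1 :: real)"
    using int[OF bergman[of "\<lambda>_. 1"]] by simp
  then have "emeasure M (space M) < \<infinity>"
    by (simp add: integrable_iff_bounded)
  then have fin: "finite_measure M"
    by (intro finite_measureI) auto
  \<comment> \<open>The moment lemma concerns Borel measures on the whole plane, so measures on the
    disc are pushed forward along the inclusion \<open>id\<close>. The closed disc serves as the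
    compact carrier.\<close>
  have fin_embed: "finite_measure (distr L borel id)"
    and supp_embed: "AE z in distr L borel id. z \<in> cball 0 1"
    and id_meas: "id \<in> L \<rightarrow>\<^sub>M borel"
    if L: "finite_measure L" "sets L = sets disc_measure" for L :: "complex measure"
  proof -
    have sp: "space L = unit_disc"
      using sets_eq_imp_space_eq[OF L(2)] by simp
    have "id \<in> disc_measure \<rightarrow>\<^sub>M borel"
      by (rule holomorphic_measurable_disc) (simp add: id_def)
    then show id: "id \<in> L \<rightarrow>\<^sub>M borel"
      using L(2) measurable_cong_sets by blast
    show "finite_measure (distr L borel id)"
      using L(1) id by (rule finite_measure.finite_measure_distr)
    show "AE z in distr L borel id. z \<in> cball 0 1"
      by (subst AE_distr_iff[OF id]) (auto simp: sp intro!: AE_I2)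
  qed
  note D = finite_measure_disc_measure refl[of "sets disc_measure"]
  note M = fin sets
  have embed: "distr M borel id = distr disc_measure borel id"
  proof (rule finite_measure_eqI_moments[where K = "cball 0 1"])
    fix j k :: nat
    define g where "g z = z ^ j * cnj z ^ k" for z
    have g_cont: "continuous_on UNIV g"
      unfolding g_def by (intro continuous_intros)
    have g_meas: "g \<in> borel_measurable borel"
      using g_cont by (rule borel_measurable_continuous_onI)
    have gint: "integrable L g" if L: "finite_measure L" "sets L = sets disc_measure" for L
    proof -
      have "integrable (distr L borel id) g"
        using g_cont integrable_continuous_compact_support[OF fin_embed[OF L] _ supp_embed[OF L]] by simp
      then show ?thesis
        using integrable_distr[OF id_meas[OF L]] by fastforce
    qed
    have re: "(LINT z|M. Re (cnj c * g z)) = (LINT z|disc_measure. Re (cnj c * g z))" for c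
    proof -
      \<comment> \<open>The cross term in the expansion of the squared modulus of \<open>q z\<close>
        is twice the real part of \<open>cnj c * g z\<close>. The three squares involved come from
        Bergman functions, so M and \<open>disc_measure\<close> agree on each.\<close>
      define q where "q z = z ^ j + c * z ^ k" for z
      have mem: "q \<in> bergman_space" "(\<lambda>z. z ^ j) \<in> bergman_space" "(\<lambda>z. c * z ^ k) \<in> bergman_space"
        unfolding q_def by (intro bergman continuous_intros holomorphic_intros)+
      have polar: "Re (cnj c * (a * cnj b))
          = ((cmod (a + c * b))\<^sup>2 - (cmod a)\<^sup>2 - (cmod (c * b))\<^sup>2) / 2" for a b
        unfolding cmod_power2 by (simp add: power2_eq_square algebra_simps)
      have expand: "Re (cnj c * g z)
          = ((cmod (q z))\<^sup>2 - (cmod (z ^ j))\<^sup>2 - (cmod (c * z ^ k))\<^sup>2) / 2" for z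
        using polar[of "z ^ j" "z ^ k"] by (simp add: q_def g_def)
      have intD: "integrable disc_measure (\<lambda>z. (cmod (f z))\<^sup>2)" if "f \<in> bergman_space" for f
        using that by (simp add: bergman_space_def)
      show ?thesis
        unfolding expand using mem[THEN int] mem[THEN eq] mem[THEN intD] by simp
    qed
    \<comment> \<open>The choice c = 1 gives the real part of g and c = i the imaginary part;
      integrability of g allows taking them outside the integral.\<close>
    have "(LINT z|M. g z) = (LINT z|disc_measure. g z)"
      using re[of 1] re[of \<i>] gint[OF M] gint[OF D]
      by (simp add: complex_eq_iff)
    then show "(LINT z|distr M borel id. z ^ j * cnj z ^ k)
        = (LINT z|distr disc_measure borel id. z ^ j * cnj z ^ k)"
      using integral_distr[OF id_meas[OF M] g_meas] integral_distr[OF id_meas[OF D] g_meas]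
      by (simp add: g_def[symmetric])
  qed (use fin_embed supp_embed M D in auto)
  show ?thesis
  proof (rule measure_eqI[OF sets])
    fix A assume "A \<in> sets M"
    then have A: "A \<in> sets borel" "A \<subseteq> unit_disc"
      using sets by (auto simp: sets_disc_measure)
    \<comment> \<open>The inclusion pulls a subset of the disc back to itself, so no information is
      lost in the plane.\<close>
    have "emeasure L A = emeasure (distr L borel id) A"
      if L: "finite_measure L" "sets L = sets disc_measure" for L
      using A sets_eq_imp_space_eq[OF L(2)]
      by (simp add: emeasure_distr[OF id_meas[OF L]] Int_absorb2)
    then show "emeasure M A = emeasure disc_measure A"
      using M D embed by metis
  qed
qed

theorem theorem4p3:
  fixes \<phi> w :: "complex \<Rightarrow> complex"
  assumes "\<phi> holomorphic_on unit_disc" and "\<phi> \<in> unit_disc \<rightarrow> unit_disc"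
    and "w holomorphic_on unit_disc"
  shows "bergman_isometry (weighted_comp w \<phi>) \<longleftrightarrow> weighted_pushforward w \<phi> = disc_measure"
proof -
  let ?\<mu> = "weighted_pushforward w \<phi>"
  have [measurable]: "w \<in> borel_measurable disc_measure"
    using assms(3) by (rule holomorphic_measurable_disc)
  have "\<phi> -` B \<inter> unit_disc \<in> sets disc_measure" if "B \<in> sets disc_measure" for B
    using measurable_sets[OF holomorphic_measurable_disc[OF assms(1)], of B] that
    by (auto simp: sets_disc_measure)
  then have \<phi>[measurable]: "\<phi> \<in> disc_measure \<rightarrow>\<^sub>M disc_measure"
    using assms(2) by (auto intro!: measurableI)
  have sets: "sets ?\<mu> = sets disc_measure"
    by (simp add: weighted_pushforward_def)
  \<comment> \<open>The squared modulus of \<open>weighted_comp w \<phi> f\<close> is the weight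
    times that of f composed with \<phi>. Integrability is recorded separately because a Bochner
    integral defaults to 0, so equal integrals alone do not transfer it.\<close>
  have change: "integrable ?\<mu> (\<lambda>z. (cmod (f z))\<^sup>2)
        \<longleftrightarrow> integrable disc_measure (\<lambda>z. (cmod (weighted_comp w \<phi> f z))\<^sup>2)"
      "(LINT z|?\<mu>. (cmod (f z))\<^sup>2) = (LINT z|disc_measure. (cmod (weighted_comp w \<phi> f z))\<^sup>2)"
    if "f \<in> bergman_space" for f
  proof -
    have [measurable]: "f \<in> borel_measurable disc_measure"
      using that by (auto simp: bergman_space_def intro: holomorphic_measurable_disc)
    show "integrable ?\<mu> (\<lambda>z. (cmod (f z))\<^sup>2)
        \<longleftrightarrow> integrable disc_measure (\<lambda>z. (cmod (weighted_comp w \<phi> f z))\<^sup>2)"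
      by (simp add: weighted_pushforward_def integrable_distr_eq integrable_density
          weighted_comp_def norm_mult power_mult_distrib)
    show "(LINT z|?\<mu>. (cmod (f z))\<^sup>2) = (LINT z|disc_measure. (cmod (weighted_comp w \<phi> f z))\<^sup>2)"
      by (simp add: weighted_pushforward_def integral_distr integral_density
          weighted_comp_def norm_mult power_mult_distrib)
  qed
  have hol: "weighted_comp w \<phi> f holomorphic_on unit_disc" if "f \<in> bergman_space" for f
  proof -
    have "(f \<circ> \<phi>) holomorphic_on unit_disc"
      using that assms(1,2) by (intro holomorphic_on_compose_gen) (auto simp: bergman_space_def)
    then show ?thesis
      using assms(3) by (auto simp: weighted_comp_def[abs_def] o_def intro!: holomorphic_on_mult)
  qed
  show ?thesis
  proof
    assume iso: "bergman_isometry (weighted_comp w \<phi>)"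
    show "?\<mu> = disc_measure"
    proof (rule disc_measure_eqI_bergman[OF sets])
      fix f assume f: "f \<in> bergman_space"
      show "integrable ?\<mu> (\<lambda>z. (cmod (f z))\<^sup>2)"
        using iso f by (simp add: change bergman_isometry_def bergman_space_def)
      \<comment> \<open>Equal norms give equal integrals because the square root is
        injective.\<close>
      show "(LINT z|?\<mu>. (cmod (f z))\<^sup>2) = (LINT z|disc_measure. (cmod (f z))\<^sup>2)"
        using iso f by (simp add: change bergman_isometry_def bergman_norm_def)
    qed
  next
    assume \<mu>: "?\<mu> = disc_measure"
    show "bergman_isometry (weighted_comp w \<phi>)"
      unfolding bergman_isometry_def
    proof (intro ballI conjI)
      \<comment> \<open>Once the two measures coincide, \<open>change\<close> compares the integrals
        of f and its image directly.\<close>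
      fix f assume f: "f \<in> bergman_space"
      then have "integrable disc_measure (\<lambda>z. (cmod (f z))\<^sup>2)"
        by (simp add: bergman_space_def)
      then show "weighted_comp w \<phi> f \<in> bergman_space"
        using change(1)[OF f, unfolded \<mu>] hol[OF f] by (simp add: bergman_space_def)
      show "bergman_norm (weighted_comp w \<phi> f) = bergman_norm f"
        using change(2)[OF f, unfolded \<mu>] by (simp add: bergman_norm_def)
    qed
  qed
qed

end
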